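(* Let $(X,T)$ be a topological flow and let $(E(X),T)$ be the induced flow on its enveloping semigroup. Then $(X,T)$ is distal if and only if $(E(X),T)$ is distal.
   Context: A (topological) flow $(X,T)$ consists of a compact Hausdorff space $X$, a topological group $T$, and a continuous map $\pi:T\times X\to X$, written $\pi(t,x)=tx$, with $(st)x=s(tx)$ and such that each $\pi^t:X\to X$, $\pi^t(x)=tx$, is a homeomorphism (so the identity of $T$ acts as the identity map). Standing assumption: the space $X$ of the given flow has no isolated points (this is not required of $E(X)$). The enveloping semigroup is $E(X)=\overline{\{\pi^t: t\in T\}}\subseteq X^X$, the closure being taken in the product topology; $T$ acts on the compact Hausdorff space $E(X)$ by $t\cdot p=\pi^t\circ p$, giving the induced flow $(E(X),T)$. The notions below apply to any compact Hausdorff space $Y$ with a continuous action of $T$, where $\mathcal{U}_Y$ denotes the unique uniformity compatible with the topology of $Y$. A pair $(x,y)\in Y\times Y$ is proximal if for every $U\in\mathcal{U}_Y$ there is $t\in T$ with $(tx,ty)\in U$; it is distal if it is not proximal. $(Y,T)$ is distal if every pair $(x,y)$ with $x\neq y$ is distal. *)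

theory Defs
  imports "HOL-Analysis.Analysis"
begin

text \<open>The class \<open>uniform_space\<close> of the library equips a whole type with a uniformity,
  whereas the enveloping semigroup is a proper subset of a function space.  Uniformities are therefore
  given here by their entourages, on an explicit carrier set.\<close>

definition uniform_structure_on :: "'a set \<Rightarrow> ('a \<times> 'a) set set \<Rightarrow> bool" where
  "uniform_structure_on S \<U> \<longleftrightarrow>
     \<U> \<noteq> {} \<and>
     (\<forall>U\<in>\<U>. Id_on S \<subseteq> U \<and> U \<subseteq> S \<times> S) \<and>
     (\<forall>U\<in>\<U>. \<forall>V. U \<subseteq> V \<and> V \<subseteq> S \<times> S \<longrightarrow> V \<in> \<U>) \<and>
     (\<forall>U\<in>\<U>. \<forall>V\<in>\<U>. U \<inter> V \<in> \<U>) \<and>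
     (\<forall>U\<in>\<U>. U\<inverse> \<in> \<U>) \<and>
     (\<forall>U\<in>\<U>. \<exists>V\<in>\<U>. V O V \<subseteq> U)"

definition compatible_uniformity :: "'a topology \<Rightarrow> ('a \<times> 'a) set set \<Rightarrow> bool" where
  "compatible_uniformity Y \<U> \<longleftrightarrow>
     uniform_structure_on (topspace Y) \<U> \<and>
     (\<forall>W. openin Y W \<longleftrightarrow> W \<subseteq> topspace Y \<and> (\<forall>x\<in>W. \<exists>U\<in>\<U>. U `` {x} \<subseteq> W))"

text \<open>Meaningful only when exactly one compatible uniformity exists, as is the case for every
  compact Hausdorff space.\<close>

definition entourages :: "'a topology \<Rightarrow> ('a \<times> 'a) set set" where
  "entourages Y = (THE \<U>. compatible_uniformity Y \<U>)"

text \<open>The acting group is a type of class \<open>topological_group_add\<close>.  That class does not assume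
  commutativity: the additive notation \<open>s + t\<close> stands for the product \<open>st\<close> of an arbitrary
  topological group.  Only the values of the action on \<open>topspace X\<close> matter.\<close>

definition flow :: "'a topology \<Rightarrow> ('t::topological_group_add \<Rightarrow> 'a \<Rightarrow> 'a) \<Rightarrow> bool" where
  "flow X \<pi> \<longleftrightarrow>
     compact_space X \<and> Hausdorff_space X \<and>
     continuous_map (prod_topology euclidean X) X (\<lambda>(t, x). \<pi> t x) \<and>
     (\<forall>s t. \<forall>x\<in>topspace X. \<pi> (s + t) x = \<pi> s (\<pi> t x)) \<and>
     (\<forall>t. homeomorphic_map X X (\<pi> t))"

definition proximal :: "'a topology \<Rightarrow> ('t \<Rightarrow> 'a \<Rightarrow> 'a) \<Rightarrow> 'a \<Rightarrow> 'a \<Rightarrow> bool" where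
  "proximal Y \<pi> x y \<longleftrightarrow> (\<forall>U\<in>entourages Y. \<exists>t. (\<pi> t x, \<pi> t y) \<in> U)"

definition distal_pair :: "'a topology \<Rightarrow> ('t \<Rightarrow> 'a \<Rightarrow> 'a) \<Rightarrow> 'a \<Rightarrow> 'a \<Rightarrow> bool" where
  "distal_pair Y \<pi> x y \<longleftrightarrow> \<not> proximal Y \<pi> x y"

definition distal_flow :: "'a topology \<Rightarrow> ('t \<Rightarrow> 'a \<Rightarrow> 'a) \<Rightarrow> bool" where
  "distal_flow Y \<pi> \<longleftrightarrow> (\<forall>x\<in>topspace Y. \<forall>y\<in>topspace Y. x \<noteq> y \<longrightarrow> distal_pair Y \<pi> x y)"

text \<open>Points of \<open>product_topology (\<lambda>_. X) (topspace X)\<close> are extensional functions, i.e. they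
  take the value \<open>undefined\<close> outside \<open>topspace X\<close>; hence the use of \<open>restrict\<close> and
  of the restricted composition \<open>compose\<close>.\<close>

definition enveloping_set :: "'a topology \<Rightarrow> ('t \<Rightarrow> 'a \<Rightarrow> 'a) \<Rightarrow> ('a \<Rightarrow> 'a) set" where
  "enveloping_set X \<pi> =
     product_topology (\<lambda>_. X) (topspace X) closure_of range (\<lambda>t. restrict (\<pi> t) (topspace X))"

definition enveloping_semigroup :: "'a topology \<Rightarrow> ('t \<Rightarrow> 'a \<Rightarrow> 'a) \<Rightarrow> ('a \<Rightarrow> 'a) topology" where
  "enveloping_semigroup X \<pi> =
     subtopology (product_topology (\<lambda>_. X) (topspace X)) (enveloping_set X \<pi>)"

definition enveloping_action ::
    "'a topology \<Rightarrow> ('t \<Rightarrow> 'a \<Rightarrow> 'a) \<Rightarrow> 't \<Rightarrow> ('a \<Rightarrow> 'a) \<Rightarrow> ('a \<Rightarrow> 'a)" where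
  "enveloping_action X \<pi> t p = compose (topspace X) (\<pi> t) p"

end

theory Submission
  imports Defs
begin

text \<open>On a compact Hausdorff space the entourages are exactly the neighbourhoods of the diagonal,
  so by compactness \<open>x\<close> and \<open>y\<close> are proximal in \<open>X\<close> iff \<open>p x = p y\<close> for some \<open>p\<close> in \<open>E(X)\<close>.
  Evaluation at a point maps proximal pairs of \<open>E(X)\<close> to proximal pairs of \<open>X\<close>, so distality of \<open>X\<close>
  passes to \<open>E(X)\<close>. Conversely, an idempotent \<open>u\<close> of \<open>E(X)\<close> is proximal to the identity \<open>e\<close> because
  \<open>u u = u e\<close>; hence if \<open>E(X)\<close> is distal, \<open>e\<close> is its only idempotent. If now \<open>p x = p y\<close>, the
  compact right topological semigroup \<open>E(X) p\<close> contains an idempotent by the Ellis--Numakura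
  theorem, so \<open>q p = e\<close> for some \<open>q\<close>, and therefore \<open>x = y\<close>.\<close>

section \<open>The uniformity of a compact Hausdorff space\<close>

definition diagonal_neighbourhoods :: "'a topology \<Rightarrow> ('a \<times> 'a) set set" where
  "diagonal_neighbourhoods Y =
     {U. U \<subseteq> topspace Y \<times> topspace Y \<and>
         (\<exists>W. openin (prod_topology Y Y) W \<and> Id_on (topspace Y) \<subseteq> W \<and> W \<subseteq> U)}"

lemma open_diagonal_neighbourhood:
  assumes "openin (prod_topology Y Y) W" "Id_on (topspace Y) \<subseteq> W"
  shows "W \<in> diagonal_neighbourhoods Y"
  using assms openin_subset[OF assms(1)] unfolding diagonal_neighbourhoods_def by auto

text \<open>The factor \<open>topspace Y \<times> topspace Y\<close> gives the empty family the
  right intersection, where \<open>\<Inter>\<close> alone would yield \<open>UNIV\<close>.\<close>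

lemma diagonal_neighbourhood_Inter:
  assumes "finite F" "\<And>x. x \<in> F \<Longrightarrow> openin (prod_topology Y Y) (W x) \<and> Id_on (topspace Y) \<subseteq> W x"
  shows "openin (prod_topology Y Y) ((topspace Y \<times> topspace Y) \<inter> (\<Inter>x\<in>F. W x)) \<and>
         Id_on (topspace Y) \<subseteq> (topspace Y \<times> topspace Y) \<inter> (\<Inter>x\<in>F. W x)"
  using assms
proof (induction F rule: finite_induct)
  case empty
  then show ?case by (auto simp: openin_prod_Times_iff)
next
  case (insert x F)
  have x: "openin (prod_topology Y Y) (W x)" "Id_on (topspace Y) \<subseteq> W x"
    using insert.prems[of x] by auto
  have F: "openin (prod_topology Y Y) ((topspace Y \<times> topspace Y) \<inter> (\<Inter>x\<in>F. W x)) \<and>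
      Id_on (topspace Y) \<subseteq> (topspace Y \<times> topspace Y) \<inter> (\<Inter>x\<in>F. W x)"
    using insert by blast
  have "openin (prod_topology Y Y) (W x \<inter> ((topspace Y \<times> topspace Y) \<inter> (\<Inter>x\<in>F. W x)))"
    using openin_Int[OF x(1) conjunct1[OF F]] .
  moreover have "W x \<inter> ((topspace Y \<times> topspace Y) \<inter> (\<Inter>x\<in>F. W x))
      = (topspace Y \<times> topspace Y) \<inter> (\<Inter>x\<in>insert x F. W x)" by auto
  ultimately show ?case using x F by auto
qed

text \<open>Local form of the halving axiom: regularity shrinks disjoint neighbourhoods of
  \<open>x\<close> and \<open>z\<close> to closed ones, so that two small steps cannot lead from
  near \<open>x\<close> to near \<open>z\<close>. It is applied to each pair outside a given
  neighbourhood of the diagonal.\<close>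

lemma diagonal_neighbourhood_separating:
  assumes reg: "regular_space Y" and haus: "Hausdorff_space Y"
    and xz: "x \<in> topspace Y" "z \<in> topspace Y" "x \<noteq> z"
  obtains V A B where "openin (prod_topology Y Y) V" "Id_on (topspace Y) \<subseteq> V"
    "openin Y A" "openin Y B" "x \<in> A" "z \<in> B" "(V O V) \<inter> (A \<times> B) = {}"
proof -
  obtain A' B' where AB': "openin Y A'" "openin Y B'" "x \<in> A'" "z \<in> B'" "disjnt A' B'"
    using haus xz unfolding Hausdorff_space_def by blast
  have nb: "neighbourhood_base_of (closedin Y) Y"
    using reg neighbourhood_base_of_closedin by blast
  obtain A CA where A: "openin Y A" "closedin Y CA" "x \<in> A" "A \<subseteq> CA" "CA \<subseteq> A'"
    using nb AB' unfolding neighbourhood_base_of by meson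
  obtain B CB where B: "openin Y B" "closedin Y CB" "z \<in> B" "B \<subseteq> CB" "CB \<subseteq> B'"
    using nb AB' unfolding neighbourhood_base_of by meson
  let ?S = "topspace Y"
  \<comment> \<open>A step in \<open>V\<close> starting in \<open>CA\<close> must end in
    \<open>A'\<close>, and one ending in \<open>CB\<close> must start in \<open>B'\<close>. The
    midpoint of a two-step path from \<open>A\<close> to \<open>B\<close> would therefore lie in
    both \<open>A'\<close> and \<open>B'\<close>, which are disjoint. The removed rectangles are
    closed and miss the diagonal because \<open>CA \<subseteq> A'\<close> and
    \<open>CB \<subseteq> B'\<close>.\<close>
  define V where "V = topspace (prod_topology Y Y) - (CA \<times> (?S - A') \<union> (?S - B') \<times> CB)"
  have "closedin (prod_topology Y Y) (CA \<times> (?S - A') \<union> (?S - B') \<times> CB)"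
    using A B AB' by (intro closedin_Un) (auto simp: closedin_prod_Times_iff)
  then have "openin (prod_topology Y Y) V" unfolding V_def by blast
  moreover have "Id_on ?S \<subseteq> V" using A B unfolding V_def by auto
  moreover have "(V O V) \<inter> (A \<times> B) = {}"
    using A B AB' unfolding V_def disjnt_def by auto
  ultimately show thesis using that A B by blast
qed

text \<open>The complement \<open>C\<close> of \<open>W\<close> is compact and lies off the
  diagonal. Finitely many of the open sets around separated pairs cover \<open>C\<close>, and the
  intersection of the corresponding \<open>V\<close> has its square disjoint from all of them, hence
  from \<open>C\<close>.\<close>

lemma diagonal_neighbourhood_half:
  assumes comp: "compact_space Y" and haus: "Hausdorff_space Y"
    and W: "openin (prod_topology Y Y) W" "Id_on (topspace Y) \<subseteq> W"
  obtains V where "openin (prod_topology Y Y) V" "Id_on (topspace Y) \<subseteq> V" "V O V \<subseteq> W"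
proof -
  let ?S = "topspace Y" and ?P = "prod_topology Y Y"
  have reg: "regular_space Y" using comp haus compact_Hausdorff_imp_regular_space by blast
  define C where "C = topspace ?P - W"
  have "compact_space ?P" using comp by (simp add: compact_space_prod_topology)
  then have Cc: "compactin ?P C"
    using W(1) unfolding C_def by (intro closedin_compact_space closedin_diff closedin_topspace)
  have "\<forall>c\<in>C. \<exists>V G. openin ?P V \<and> Id_on ?S \<subseteq> V \<and> openin ?P G \<and> c \<in> G \<and> (V O V) \<inter> G = {}"
  proof
    fix c assume c: "c \<in> C"
    obtain x z where xz: "c = (x, z)" by fastforce
    with c W have "x \<in> ?S" "z \<in> ?S" "x \<noteq> z" unfolding C_def by auto
    then obtain V A B where "openin ?P V" "Id_on ?S \<subseteq> V"
        "openin Y A" "openin Y B" "x \<in> A" "z \<in> B" "(V O V) \<inter> (A \<times> B) = {}"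
      using diagonal_neighbourhood_separating[OF reg haus] by metis
    then show "\<exists>V G. openin ?P V \<and> Id_on ?S \<subseteq> V \<and> openin ?P G \<and> c \<in> G \<and> (V O V) \<inter> G = {}"
      using xz by (intro exI[of _ V] exI[of _ "A \<times> B"]) (auto simp: openin_prod_Times_iff)
  qed
  then obtain V G where VG: "\<And>c. c \<in> C \<Longrightarrow> openin ?P (V c) \<and> Id_on ?S \<subseteq> V c \<and>
      openin ?P (G c) \<and> c \<in> G c \<and> (V c O V c) \<inter> G c = {}" by metis
  have "C \<subseteq> \<Union>(G ` C)" using VG by blast
  moreover have "\<forall>U\<in>G ` C. openin ?P U" using VG by blast
  ultimately obtain \<F> where "finite \<F>" "\<F> \<subseteq> G ` C" "C \<subseteq> \<Union>\<F>"
    using Cc unfolding compactin_def by meson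
  then obtain F where F: "finite F" "F \<subseteq> C" "C \<subseteq> \<Union>(G ` F)"
    by (metis finite_subset_image)
  define V0 where "V0 = (?S \<times> ?S) \<inter> (\<Inter>c\<in>F. V c)"
  have "openin ?P V0 \<and> Id_on ?S \<subseteq> V0"
    unfolding V0_def by (rule diagonal_neighbourhood_Inter[OF F(1)]) (use F VG in blast)
  moreover have "V0 O V0 \<subseteq> W"
  proof (rule ccontr)
    assume "\<not> V0 O V0 \<subseteq> W"
    then obtain a b where ab: "(a, b) \<in> V0 O V0" "(a, b) \<notin> W" by auto
    then have "(a, b) \<in> C" unfolding C_def V0_def by auto
    then obtain c where c: "c \<in> F" "(a, b) \<in> G c" using F by blast
    have "(a, b) \<in> V c O V c" using ab c unfolding V0_def by auto
    then show False using VG c F by blast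
  qed
  ultimately show thesis using that by blast
qed

lemma uniform_structure_on_diagonal_neighbourhoods:
  assumes "compact_space Y" "Hausdorff_space Y"
  shows "uniform_structure_on (topspace Y) (diagonal_neighbourhoods Y)"
  unfolding uniform_structure_on_def
proof (intro conjI ballI allI impI)
  let ?S = "topspace Y" and ?P = "prod_topology Y Y"
  have "?S \<times> ?S \<in> diagonal_neighbourhoods Y"
    by (rule open_diagonal_neighbourhood) (auto simp: openin_prod_Times_iff)
  then show "diagonal_neighbourhoods Y \<noteq> {}" by auto
  fix U assume U: "U \<in> diagonal_neighbourhoods Y"
  then obtain W where W: "openin ?P W" "Id_on ?S \<subseteq> W" "W \<subseteq> U" "U \<subseteq> ?S \<times> ?S"
    unfolding diagonal_neighbourhoods_def by blast
  show "Id_on ?S \<subseteq> U" "U \<subseteq> ?S \<times> ?S" using W by auto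
  show "V \<in> diagonal_neighbourhoods Y" if "U \<subseteq> V \<and> V \<subseteq> ?S \<times> ?S" for V
    using W that unfolding diagonal_neighbourhoods_def by blast
  show "U \<inter> V \<in> diagonal_neighbourhoods Y" if "V \<in> diagonal_neighbourhoods Y" for V
  proof -
    obtain W' where "openin ?P W'" "Id_on ?S \<subseteq> W'" "W' \<subseteq> V"
      using \<open>V \<in> _\<close> unfolding diagonal_neighbourhoods_def by blast
    then have "openin ?P (W \<inter> W') \<and> Id_on ?S \<subseteq> W \<inter> W' \<and> W \<inter> W' \<subseteq> U \<inter> V" using W by auto
    then show ?thesis using W(4) unfolding diagonal_neighbourhoods_def by blast
  qed
  show "U\<inverse> \<in> diagonal_neighbourhoods Y"
  proof -
    have "homeomorphic_map ?P ?P (\<lambda>(x, y). (y, x))" by (rule homeomorphic_map_swap)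
    then have "openin ?P ((\<lambda>(x, y). (y, x)) ` W)"
      using W(1) homeomorphic_imp_open_map unfolding open_map_def by blast
    moreover have "(\<lambda>(x, y). (y, x)) ` W = W\<inverse>" by force
    ultimately have "openin ?P (W\<inverse>) \<and> Id_on ?S \<subseteq> W\<inverse> \<and> W\<inverse> \<subseteq> U\<inverse>" using W by auto
    moreover have "U\<inverse> \<subseteq> ?S \<times> ?S" using W(4) by auto
    ultimately show ?thesis unfolding diagonal_neighbourhoods_def by blast
  qed
  obtain V where "openin ?P V" "Id_on ?S \<subseteq> V" "V O V \<subseteq> W"
    using diagonal_neighbourhood_half[OF assms W(1,2)] by blast
  then show "\<exists>V\<in>diagonal_neighbourhoods Y. V O V \<subseteq> U"
    using W(3) open_diagonal_neighbourhood by blast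
qed

lemma compatible_uniformity_diagonal_neighbourhoods:
  assumes comp: "compact_space Y" and haus: "Hausdorff_space Y"
  shows "compatible_uniformity Y (diagonal_neighbourhoods Y)"
  unfolding compatible_uniformity_def
proof (intro conjI allI iffI)
  let ?S = "topspace Y" and ?P = "prod_topology Y Y"
  show "uniform_structure_on ?S (diagonal_neighbourhoods Y)"
    using assms by (rule uniform_structure_on_diagonal_neighbourhoods)
  fix W
  show "W \<subseteq> ?S" if "openin Y W" using that by (rule openin_subset)
  show "\<forall>x\<in>W. \<exists>U\<in>diagonal_neighbourhoods Y. U `` {x} \<subseteq> W" if W: "openin Y W"
  proof
    fix x assume x: "x \<in> W"
    then have xS: "x \<in> ?S" using W openin_subset by blast
    then have "closedin Y {x}"
      using haus by (simp add: closedin_Hausdorff_sing_eq)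
    then have "openin Y (?S - {x})" by blast
    \<comment> \<open>An open neighbourhood of the diagonal whose section at \<open>x\<close> is
      exactly \<open>W\<close>: the second rectangle restores the diagonal at the other points but
      contributes nothing over \<open>x\<close>.\<close>
    then have "openin ?P (W \<times> W \<union> (?S - {x}) \<times> ?S)"
      using W by (intro openin_Un) (auto simp: openin_prod_Times_iff)
    moreover have "Id_on ?S \<subseteq> W \<times> W \<union> (?S - {x}) \<times> ?S" using x by auto
    ultimately have "W \<times> W \<union> (?S - {x}) \<times> ?S \<in> diagonal_neighbourhoods Y"
      by (rule open_diagonal_neighbourhood)
    then show "\<exists>U\<in>diagonal_neighbourhoods Y. U `` {x} \<subseteq> W" by (rule bexI[rotated]) auto
  qed
  show "openin Y W"
    if W: "W \<subseteq> ?S \<and> (\<forall>x\<in>W. \<exists>U\<in>diagonal_neighbourhoods Y. U `` {x} \<subseteq> W)"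
    unfolding openin_subopen[of Y W]
  proof
    fix x assume x: "x \<in> W"
    then obtain U where U: "U \<in> diagonal_neighbourhoods Y" "U `` {x} \<subseteq> W" using W by blast
    then obtain V where V: "openin ?P V" "Id_on ?S \<subseteq> V" "V \<subseteq> U"
      unfolding diagonal_neighbourhoods_def by blast
    have xS: "x \<in> ?S" using x W by blast
    then have "(x, x) \<in> V" using V by auto
    then obtain A B where AB: "openin Y A" "openin Y B" "x \<in> A" "x \<in> B" "A \<times> B \<subseteq> V"
      using V(1) unfolding openin_prod_topology_alt by meson
    then have "B \<subseteq> W" using V(3) U(2) by blast
    then show "\<exists>T. openin Y T \<and> x \<in> T \<and> T \<subseteq> W" using AB by blast
  qed
qed

section \<open>Uniqueness of the compatible uniformity\<close>

lemma uniform_structure_onD: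
  assumes "uniform_structure_on S \<U>" "U \<in> \<U>"
  shows "x \<in> S \<Longrightarrow> (x, x) \<in> U"
    and "U \<subseteq> S \<times> S"
    and "U \<subseteq> V \<Longrightarrow> V \<subseteq> S \<times> S \<Longrightarrow> V \<in> \<U>"
    and "V \<in> \<U> \<Longrightarrow> U \<inter> V \<in> \<U>"
    and "U\<inverse> \<in> \<U>"
    and "\<exists>V\<in>\<U>. V O V \<subseteq> U"
proof -
  note d = assms(1)[unfolded uniform_structure_on_def, THEN conjunct2]
  note * = d[THEN conjunct1, THEN bspec, OF assms(2)]
    d[THEN conjunct2, THEN conjunct1, THEN bspec, OF assms(2)]
    d[THEN conjunct2, THEN conjunct2, THEN conjunct1, THEN bspec, OF assms(2)]
    d[THEN conjunct2, THEN conjunct2, THEN conjunct2, THEN conjunct1, THEN bspec, OF assms(2)]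
    d[THEN conjunct2, THEN conjunct2, THEN conjunct2, THEN conjunct2, THEN bspec, OF assms(2)]
  show "x \<in> S \<Longrightarrow> (x, x) \<in> U" "U \<subseteq> S \<times> S" using *(1) by auto
  show "U \<subseteq> V \<Longrightarrow> V \<subseteq> S \<times> S \<Longrightarrow> V \<in> \<U>" using *(2) by blast
  show "V \<in> \<U> \<Longrightarrow> U \<inter> V \<in> \<U>" using *(3) by blast
  show "U\<inverse> \<in> \<U>" "\<exists>V\<in>\<U>. V O V \<subseteq> U" using *(4,5) by auto
qed

lemma compatible_uniformity_openinI:
  assumes "compatible_uniformity Y \<U>" "W \<subseteq> topspace Y" "\<And>x. x \<in> W \<Longrightarrow> \<exists>U\<in>\<U>. U `` {x} \<subseteq> W"
  shows "openin Y W"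
  by (rule assms(1)[unfolded compatible_uniformity_def, THEN conjunct2, THEN spec, of W, THEN iffD2])
    (use assms(2,3) in auto)

lemma compatible_uniformity_interior:
  assumes \<U>: "compatible_uniformity Y \<U>" and V: "V \<in> \<U>" and x: "x \<in> topspace Y"
  obtains A where "openin Y A" "x \<in> A" "A \<subseteq> V `` {x}"
proof -
  have u: "uniform_structure_on (topspace Y) \<U>"
    using \<U> unfolding compatible_uniformity_def by blast
  \<comment> \<open>The uniform interior of \<open>V\<close>
    {x}\<open>. It is open by halving: if\<close>U\<open>witnesses that\<close>y\<open>belongs to\<close>A\<open>and\<close>U'
    O U' \<subseteq> U\<open>, then\<close>U'\<open>is a witness for every point of\<close>U'
    \<open>{y}\<close>.\<close>
  define A where "A = {y \<in> topspace Y. \<exists>U\<in>\<U>. U `` {y} \<subseteq> V `` {x}}"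
  have "openin Y A"
  proof -
    have "\<exists>U\<in>\<U>. U `` {y} \<subseteq> A" if y: "y \<in> A" for y
    proof -
      obtain U where U: "U \<in> \<U>" "U `` {y} \<subseteq> V `` {x}" using y unfolding A_def by blast
      obtain U' where U': "U' \<in> \<U>" "U' O U' \<subseteq> U"
        using uniform_structure_onD(6)[OF u U(1)] by blast
      have "U' \<subseteq> topspace Y \<times> topspace Y" using u U'(1) by (rule uniform_structure_onD)
      then have "U' `` {y} \<subseteq> A" using U U' unfolding A_def by blast
      then show ?thesis using U' by blast
    qed
    moreover have "A \<subseteq> topspace Y" unfolding A_def by blast
    ultimately show ?thesis using compatible_uniformity_openinI[OF \<U>] by blast
  qed
  moreover have "x \<in> A" using x V unfolding A_def by blast
  moreover have "A \<subseteq> V `` {x}"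
  proof
    fix y assume "y \<in> A"
    then obtain U where "U \<in> \<U>" "U `` {y} \<subseteq> V `` {x}" "y \<in> topspace Y" unfolding A_def by blast
    moreover have "(y, y) \<in> U" using uniform_structure_onD(1)[OF u] calculation by blast
    ultimately show "y \<in> V `` {x}" by blast
  qed
  ultimately show thesis using that by blast
qed

lemma uniform_structure_on_symmetric_half:
  assumes "uniform_structure_on S \<U>" "U \<in> \<U>"
  obtains V where "V \<in> \<U>" "V\<inverse> = V" "V O V \<subseteq> U"
proof -
  obtain V where V: "V \<in> \<U>" "V O V \<subseteq> U"
    using uniform_structure_onD(6)[OF assms] by blast
  have "V \<inter> V\<inverse> \<in> \<U>" by (intro uniform_structure_onD(4,5)[OF assms(1)] V(1))
  then show thesis using that[of "V \<inter> V\<inverse>"] V by blast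
qed

lemma uniform_structure_on_Inter:
  assumes u: "uniform_structure_on S \<U>" and "finite F" "\<And>x. x \<in> F \<Longrightarrow> V x \<in> \<U>"
  shows "(S \<times> S) \<inter> (\<Inter>x\<in>F. V x) \<in> \<U>"
  using assms(2,3)
proof (induction F rule: finite_induct)
  case empty
  have "\<U> \<noteq> {}" using u unfolding uniform_structure_on_def by simp
  then obtain U where "U \<in> \<U>" by blast
  with uniform_structure_onD(2)[OF u this] have "S \<times> S \<in> \<U>" using uniform_structure_onD(3)[OF u] by blast
  then show ?case by simp
next
  case (insert x F)
  have "V x \<inter> ((S \<times> S) \<inter> (\<Inter>x\<in>F. V x)) \<in> \<U>"
    by (rule uniform_structure_onD(4)[OF u]) (use insert in simp_all)
  moreover have "V x \<inter> ((S \<times> S) \<inter> (\<Inter>x\<in>F. V x)) = (S \<times> S) \<inter> (\<Inter>x\<in>insert x F. V x)" by auto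
  ultimately show ?case by simp
qed

lemma compatible_uniformity_unique:
  assumes comp: "compact_space Y" and \<U>: "compatible_uniformity Y \<U>"
  shows "\<U> = diagonal_neighbourhoods Y"
proof
  let ?S = "topspace Y" and ?P = "prod_topology Y Y"
  have u: "uniform_structure_on ?S \<U>"
    using \<U> unfolding compatible_uniformity_def by blast
  show "\<U> \<subseteq> diagonal_neighbourhoods Y"
  proof
    fix U assume U: "U \<in> \<U>"
    then obtain V where V: "V \<in> \<U>" "V\<inverse> = V" "V O V \<subseteq> U"
      using uniform_structure_on_symmetric_half[OF u] by metis
    have "\<forall>x\<in>?S. \<exists>A. openin Y A \<and> x \<in> A \<and> A \<subseteq> V `` {x}"
      using compatible_uniformity_interior[OF \<U> V(1)] by metis
    then obtain A where A: "\<And>x. x \<in> ?S \<Longrightarrow> openin Y (A x) \<and> x \<in> A x \<and> A x \<subseteq> V `` {x}"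
      by metis
    \<comment> \<open>Two points of the same \<open>A x\<close> are both \<open>V\<close>-close to
      \<open>x\<close>. By symmetry of \<open>V\<close> they form a pair in \<open>V O V\<close>, so
      this open neighbourhood of the diagonal lies inside \<open>U\<close>.\<close>
    have "openin ?P (\<Union>x\<in>?S. A x \<times> A x)"
      using A by (intro openin_Union) (auto simp: openin_prod_Times_iff)
    moreover have "Id_on ?S \<subseteq> (\<Union>x\<in>?S. A x \<times> A x)" using A by blast
    moreover have "(\<Union>x\<in>?S. A x \<times> A x) \<subseteq> U" using A V by blast
    moreover have "U \<subseteq> ?S \<times> ?S" using u U by (rule uniform_structure_onD)
    ultimately show "U \<in> diagonal_neighbourhoods Y" unfolding diagonal_neighbourhoods_def by blast
  qed
  show "diagonal_neighbourhoods Y \<subseteq> \<U>"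
  proof
    fix M assume "M \<in> diagonal_neighbourhoods Y"
    then obtain W where W: "openin ?P W" "Id_on ?S \<subseteq> W" "W \<subseteq> M" "M \<subseteq> ?S \<times> ?S"
      unfolding diagonal_neighbourhoods_def by blast
    \<comment> \<open>A Lebesgue number argument: once finitely many \<open>A x\<close> cover the
      space, the intersection of their \<open>V x\<close> is an entourage inside \<open>W\<close>.
      For \<open>(a, b)\<close> in it and \<open>a\<close> in \<open>A x\<close>, the paths from
      \<open>x\<close> through \<open>a\<close> to \<open>b\<close> and from \<open>x\<close>
      through \<open>a\<close> to \<open>a\<close> put both points into \<open>B x\<close>, whose
      square lies in \<open>W\<close>.\<close>
    have "\<forall>x\<in>?S. \<exists>B V A. B \<times> B \<subseteq> W \<and> V \<in> \<U> \<and> (V O V) `` {x} \<subseteq> B \<and>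
        openin Y A \<and> x \<in> A \<and> A \<subseteq> V `` {x}"
    proof
      fix x assume x: "x \<in> ?S"
      then have "(x, x) \<in> W" using W by auto
      then obtain A A' where A: "openin Y A" "openin Y A'" "x \<in> A" "x \<in> A'" "A \<times> A' \<subseteq> W"
        using W(1) unfolding openin_prod_topology_alt by meson
      then have "openin Y (A \<inter> A')" "x \<in> A \<inter> A'" by auto
      then obtain U where U: "U \<in> \<U>" "U `` {x} \<subseteq> A \<inter> A'"
        using \<U> unfolding compatible_uniformity_def by metis
      obtain V where V: "V \<in> \<U>" "V O V \<subseteq> U"
        using uniform_structure_on_symmetric_half[OF u U(1)] by metis
      obtain D where "openin Y D" "x \<in> D" "D \<subseteq> V `` {x}"
        using compatible_uniformity_interior[OF \<U> V(1) x] by metis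
      moreover have "(V O V) `` {x} \<subseteq> A \<inter> A'" using U V by blast
      moreover have "(A \<inter> A') \<times> (A \<inter> A') \<subseteq> W" using A by blast
      ultimately show "\<exists>B V A. B \<times> B \<subseteq> W \<and> V \<in> \<U> \<and> (V O V) `` {x} \<subseteq> B \<and>
        openin Y A \<and> x \<in> A \<and> A \<subseteq> V `` {x}" using V(1) by blast
    qed
    then obtain B V A where BVA: "\<And>x. x \<in> ?S \<Longrightarrow> B x \<times> B x \<subseteq> W \<and> V x \<in> \<U> \<and>
        (V x O V x) `` {x} \<subseteq> B x \<and> openin Y (A x) \<and> x \<in> A x \<and> A x \<subseteq> V x `` {x}"
      by metis
    have "?S \<subseteq> \<Union>(A ` ?S)" using BVA by blast
    moreover have "\<forall>U\<in>A ` ?S. openin Y U" using BVA by blast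
    ultimately obtain \<F> where "finite \<F>" "\<F> \<subseteq> A ` ?S" "?S \<subseteq> \<Union>\<F>"
      using comp unfolding compact_space_def compactin_def by meson
    then obtain F where F: "finite F" "F \<subseteq> ?S" "?S \<subseteq> \<Union>(A ` F)"
      by (metis finite_subset_image)
    define V0 where "V0 = (?S \<times> ?S) \<inter> (\<Inter>x\<in>F. V x)"
    have V0: "V0 \<in> \<U>"
      unfolding V0_def by (rule uniform_structure_on_Inter[OF u]) (use F BVA in auto)
    have "V0 \<subseteq> W"
    proof clarify
      fix a b assume ab: "(a, b) \<in> V0"
      then have "a \<in> ?S" unfolding V0_def by blast
      then obtain x where x: "x \<in> F" "a \<in> A x" using F by blast
      then have xS: "x \<in> ?S" using F by blast
      have xa: "(x, a) \<in> V x" using BVA[OF xS] x by blast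
      have "(a, b) \<in> V x" using ab x unfolding V0_def by blast
      then have "b \<in> B x" using xa BVA[OF xS] by blast
      moreover have "(a, a) \<in> V x"
        using uniform_structure_onD(1)[OF u] BVA[OF xS] \<open>a \<in> ?S\<close> by blast
      then have "a \<in> B x" using xa BVA[OF xS] by blast
      ultimately show "(a, b) \<in> W" using BVA[OF xS] by blast
    qed
    then have "V0 \<subseteq> M" using W by blast
    then show "M \<in> \<U>" using uniform_structure_onD(3)[OF u V0] W(4) by blast
  qed
qed

text \<open>Existence and uniqueness together evaluate the definite description behind
  \<open>entourages\<close>.\<close>

lemma entourages_compact_Hausdorff:
  assumes "compact_space Y" "Hausdorff_space Y"
  shows "entourages Y = diagonal_neighbourhoods Y"
  unfolding entourages_def
  by (rule the_equality[of "compatible_uniformity Y",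
        OF compatible_uniformity_diagonal_neighbourhoods[OF assms]
          compatible_uniformity_unique[OF assms(1)]])

text \<open>Every entourage contains an open one, so proximality may be tested on open
  neighbourhoods of the diagonal. All later arguments use this form.\<close>

lemma proximal_compact_Hausdorff_iff:
  assumes "compact_space Y" "Hausdorff_space Y"
  shows "proximal Y \<pi> x y \<longleftrightarrow>
    (\<forall>W. openin (prod_topology Y Y) W \<longrightarrow> Id_on (topspace Y) \<subseteq> W \<longrightarrow>
      (\<exists>t. (\<pi> t x, \<pi> t y) \<in> W))"
proof
  assume "proximal Y \<pi> x y"
  then show "\<forall>W. openin (prod_topology Y Y) W \<longrightarrow> Id_on (topspace Y) \<subseteq> W \<longrightarrow>
      (\<exists>t. (\<pi> t x, \<pi> t y) \<in> W)"
    unfolding proximal_def entourages_compact_Hausdorff[OF assms]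
    using open_diagonal_neighbourhood by blast
next
  assume R: "\<forall>W. openin (prod_topology Y Y) W \<longrightarrow> Id_on (topspace Y) \<subseteq> W \<longrightarrow>
      (\<exists>t. (\<pi> t x, \<pi> t y) \<in> W)"
  show "proximal Y \<pi> x y"
    unfolding proximal_def entourages_compact_Hausdorff[OF assms]
  proof
    fix U assume "U \<in> diagonal_neighbourhoods Y"
    then obtain W where "openin (prod_topology Y Y) W" "Id_on (topspace Y) \<subseteq> W" "W \<subseteq> U"
      unfolding diagonal_neighbourhoods_def by blast
    then show "\<exists>t. (\<pi> t x, \<pi> t y) \<in> U" using R by blast
  qed
qed

section \<open>Idempotents in compact right topological semigroups\<close>

text \<open>Supplies the finite intersection property for chains of nonempty closed sets in the Zorn
  argument below.\<close>

lemma finite_chain_Inter_mem: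
  assumes "finite F" "F \<noteq> {}" "\<And>a b. a \<in> F \<Longrightarrow> b \<in> F \<Longrightarrow> a \<subseteq> b \<or> b \<subseteq> a"
  shows "\<Inter>F \<in> F"
  using assms
proof (induction F rule: finite_ne_induct)
  case (insert x F)
  then have "\<Inter>F \<in> F" by blast
  then have "x \<subseteq> \<Inter>F \<or> \<Inter>F \<subseteq> x" using insert.prems by blast
  then show ?case using \<open>\<Inter>F \<in> F\<close> by (auto simp: Int_absorb1 Int_absorb2)
qed auto

text \<open>Zorn's lemma for reverse inclusion: the intersection of a chain of nonempty closed
  subsemigroups is again a closed subsemigroup, and compactness keeps it nonempty.\<close>

lemma minimal_closed_subsemigroup:
  fixes m :: "'b \<Rightarrow> 'b \<Rightarrow> 'b"
  assumes comp: "compact_space Y" and ne: "topspace Y \<noteq> {}"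
    and cl: "\<And>a b. a \<in> topspace Y \<Longrightarrow> b \<in> topspace Y \<Longrightarrow> m a b \<in> topspace Y"
  obtains A where "closedin Y A" "A \<noteq> {}" "\<forall>a\<in>A. \<forall>b\<in>A. m a b \<in> A"
    "\<forall>B\<subseteq>A. closedin Y B \<longrightarrow> B \<noteq> {} \<longrightarrow> (\<forall>a\<in>B. \<forall>b\<in>B. m a b \<in> B) \<longrightarrow> B = A"
proof -
  define \<A> where "\<A> = {A. closedin Y A \<and> A \<noteq> {} \<and> (\<forall>a\<in>A. \<forall>b\<in>A. m a b \<in> A)}"
  have top: "topspace Y \<in> \<A>" using ne cl unfolding \<A>_def by auto
  have "\<exists>A\<in>\<A>. \<forall>B\<in>\<A>. A \<supseteq> B \<longrightarrow> B = A"
  proof (rule predicate_Zorn)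
    show "partial_order_on \<A> (relation_of (\<lambda>a b. b \<subseteq> a) \<A>)"
      by (rule partial_order_on_relation_ofI) auto
  next
    fix C assume C: "C \<in> Chains (relation_of (\<lambda>a b. b \<subseteq> a) \<A>)"
    have CA: "C \<subseteq> \<A>" using C by (rule Chains_relation_of)
    have chain: "a \<subseteq> b \<or> b \<subseteq> a" if "a \<in> C" "b \<in> C" for a b
      using C that unfolding Chains_def relation_of_def by blast
    show "\<exists>u\<in>\<A>. \<forall>a\<in>C. u \<subseteq> a"
    \<comment> \<open>The empty chain is split off because its intersection would be
      \<open>UNIV\<close>; the whole space bounds it instead.\<close>
    proof (cases "C = {}")
      case True
      then show ?thesis using top by blast
    next
      case False
      have "\<Inter>F \<noteq> {}" if F: "finite F" "F \<subseteq> C" for F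
      proof (cases "F = {}")
        case nonempty: False
        have "\<Inter>F \<in> F" by (rule finite_chain_Inter_mem[OF F(1) nonempty]) (use F chain in blast)
        then show ?thesis using F CA unfolding \<A>_def by blast
      qed auto
      moreover have "\<forall>A\<in>C. closedin Y A" using CA unfolding \<A>_def by blast
      ultimately have "\<Inter>C \<noteq> {}"
        using comp[unfolded compact_space_fip, rule_format, of C] by simp
      moreover have "closedin Y (\<Inter>C)"
        using False CA unfolding \<A>_def by (intro closedin_Inter) auto
      moreover have "\<forall>a\<in>\<Inter>C. \<forall>b\<in>\<Inter>C. m a b \<in> \<Inter>C" using CA unfolding \<A>_def by blast
      ultimately have "\<Inter>C \<in> \<A>" unfolding \<A>_def by blast
      then show ?thesis by blast
    qed
  qed
  then obtain A where A: "A \<in> \<A>" "\<And>B. B \<in> \<A> \<Longrightarrow> B \<subseteq> A \<Longrightarrow> B = A" by blast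
  show thesis
  proof (rule that)
    show "closedin Y A" "A \<noteq> {}" "\<forall>a\<in>A. \<forall>b\<in>A. m a b \<in> A"
      using A(1) unfolding \<A>_def by auto
    show "\<forall>B\<subseteq>A. closedin Y B \<longrightarrow> B \<noteq> {} \<longrightarrow> (\<forall>a\<in>B. \<forall>b\<in>B. m a b \<in> B) \<longrightarrow> B = A"
    proof (intro allI impI)
      fix B assume B: "B \<subseteq> A" "closedin Y B" "B \<noteq> {}" "\<forall>a\<in>B. \<forall>b\<in>B. m a b \<in> B"
      then have "B \<in> \<A>" unfolding \<A>_def by simp
      then show "B = A" using A(2) B(1) by blast
    qed
  qed
qed

text \<open>Take \<open>u\<close> in a minimal closed subsemigroup \<open>A\<close>. Right
  translation by \<open>u\<close> is continuous, so \<open>A u\<close> is compact, hence a closed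
  subsemigroup of \<open>A\<close>, and minimality gives \<open>A u = A\<close>.\<close>

theorem Ellis_Numakura:
  fixes m :: "'b \<Rightarrow> 'b \<Rightarrow> 'b"
  assumes comp: "compact_space Y" and haus: "Hausdorff_space Y" and ne: "topspace Y \<noteq> {}"
    and cl: "\<And>a b. a \<in> topspace Y \<Longrightarrow> b \<in> topspace Y \<Longrightarrow> m a b \<in> topspace Y"
    and assoc: "\<And>a b c. a \<in> topspace Y \<Longrightarrow> b \<in> topspace Y \<Longrightarrow> c \<in> topspace Y \<Longrightarrow>
      m (m a b) c = m a (m b c)"
    and cont: "\<And>p. p \<in> topspace Y \<Longrightarrow> continuous_map Y Y (\<lambda>q. m q p)"
  obtains u where "u \<in> topspace Y" "m u u = u"
proof -
  obtain A where A: "closedin Y A" "A \<noteq> {}" and Am': "\<forall>a\<in>A. \<forall>b\<in>A. m a b \<in> A"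
    and min': "\<forall>B\<subseteq>A. closedin Y B \<longrightarrow> B \<noteq> {} \<longrightarrow> (\<forall>a\<in>B. \<forall>b\<in>B. m a b \<in> B) \<longrightarrow> B = A"
    by (rule minimal_closed_subsemigroup[where m = m, OF comp ne cl])
  have Am: "m a b \<in> A" if "a \<in> A" "b \<in> A" for a b using Am' that by blast
  have min: "B = A" if "closedin Y B" "B \<noteq> {}" "\<And>a b. a \<in> B \<Longrightarrow> b \<in> B \<Longrightarrow> m a b \<in> B" "B \<subseteq> A"
    for B using min' that by simp
  have AS: "a \<in> topspace Y" if "a \<in> A" for a using A that closedin_subset by blast
  obtain u where u: "u \<in> A" using A by blast
  have "(\<lambda>q. m q u) ` A = A"
  proof (rule min)
    have "compactin Y A" using comp A(1) by (rule closedin_compact_space)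
    then show "closedin Y ((\<lambda>q. m q u) ` A)"
      using image_compactin[OF _ cont[OF AS[OF u]]] compactin_imp_closedin[OF haus] by blast
    show "(\<lambda>q. m q u) ` A \<noteq> {}" using u by blast
    show "(\<lambda>q. m q u) ` A \<subseteq> A" using Am u by blast
    fix a b assume "a \<in> (\<lambda>q. m q u) ` A" "b \<in> (\<lambda>q. m q u) ` A"
    then obtain c d where "a = m c u" "b = m d u" "c \<in> A" "d \<in> A" by blast
    then have "m a b = m (m a d) u" "m a d \<in> A" using assoc AS Am u by auto
    then show "m a b \<in> (\<lambda>q. m q u) ` A" by blast
  qed
  then obtain v where v: "v \<in> A" "m v u = u" using u by (metis imageE)
  \<comment> \<open>The left stabiliser of \<open>u\<close> in \<open>A\<close> contains
    \<open>v\<close>, is closed as the preimage of a point, and is a subsemigroup. By minimality it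
    is all of \<open>A\<close>, so it contains \<open>u\<close> itself.\<close>
  have "{q \<in> A. m q u = u} = A"
  proof (rule min)
    have "closedin Y {u}" using haus AS[OF u] by (simp add: closedin_Hausdorff_sing_eq)
    then have "closedin Y {q \<in> topspace Y. m q u \<in> {u}}"
      using cont[OF AS[OF u]] closedin_continuous_map_preimage by blast
    then have "closedin Y (A \<inter> {q \<in> topspace Y. m q u \<in> {u}})" using A(1) by blast
    moreover have "A \<inter> {q \<in> topspace Y. m q u \<in> {u}} = {q \<in> A. m q u = u}" using AS by auto
    ultimately show "closedin Y {q \<in> A. m q u = u}" by simp
    show "{q \<in> A. m q u = u} \<noteq> {}" using v by blast
    show "m a b \<in> {q \<in> A. m q u = u}" if "a \<in> {q \<in> A. m q u = u}" "b \<in> {q \<in> A. m q u = u}" for a b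
      using that assoc AS Am u by auto
  qed auto
  then have "m u u = u" using u by blast
  then show thesis using that AS u by blast
qed

section \<open>The enveloping semigroup\<close>

text \<open>The coordinate of \<open>compose S q p\<close> at \<open>x\<close> is the projection of
  \<open>q\<close> to the coordinate \<open>p x\<close>, so right translation is continuous even
  when \<open>p\<close> is discontinuous. Left composition, treated next, applies \<open>f\<close>
  after each projection and relies on the continuity of \<open>f\<close>.\<close>

lemma continuous_map_compose_right:
  assumes "p \<in> S \<rightarrow> S"
  shows "continuous_map (product_topology (\<lambda>_. X) S) (product_topology (\<lambda>_. X) S)
    (\<lambda>q. compose S q p)"
  unfolding continuous_map_componentwise
proof (intro conjI ballI)
  show "(\<lambda>q. compose S q p) ` topspace (product_topology (\<lambda>_. X) S) \<subseteq> extensional S"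
    by (auto simp: compose_def)
  fix x assume "x \<in> S"
  then show "continuous_map (product_topology (\<lambda>_. X) S) X (\<lambda>q. compose S q p x)"
    using assms by (auto simp: compose_def intro!: continuous_map_product_projection)
qed

lemma continuous_map_compose_left:
  assumes "continuous_map X X f"
  shows "continuous_map (product_topology (\<lambda>_. X) S) (product_topology (\<lambda>_. X) S) (compose S f)"
  unfolding continuous_map_componentwise
proof (intro conjI ballI)
  show "compose S f ` topspace (product_topology (\<lambda>_. X) S) \<subseteq> extensional S"
    by (auto simp: compose_def)
  fix x assume x: "x \<in> S"
  have "continuous_map (product_topology (\<lambda>_. X) S) X (f \<circ> (\<lambda>q. q x))"
    using x assms by (intro continuous_map_compose[of _ X] continuous_map_product_projection)
  then show "continuous_map (product_topology (\<lambda>_. X) S) X (\<lambda>q. compose S f q x)"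
    using x by (simp add: compose_def o_def)
qed

section \<open>Algebra and topology of the enveloping semigroup of a fixed flow\<close>

context
  fixes X :: "'a topology"
    and \<pi> :: "'t::topological_group_add \<Rightarrow> 'a \<Rightarrow> 'a"
  assumes flow: "flow X \<pi>"
begin

abbreviation (input) "S \<equiv> topspace X"
abbreviation (input) "P \<equiv> product_topology (\<lambda>_. X) (topspace X)"
abbreviation (input) "E \<equiv> enveloping_set X \<pi>"
abbreviation (input) "ES \<equiv> enveloping_semigroup X \<pi>"
abbreviation (input) "g \<equiv> \<lambda>t. restrict (\<pi> t) (topspace X)"

lemma flow_compact: "compact_space X" and flow_Hausdorff: "Hausdorff_space X"
  using flow unfolding flow_def by auto

lemma flow_add: "x \<in> S \<Longrightarrow> \<pi> (s + t) x = \<pi> s (\<pi> t x)"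
  using flow unfolding flow_def by blast

lemma flow_homeomorphic: "homeomorphic_map X X (\<pi> t)"
  using flow unfolding flow_def by blast

lemma flow_continuous: "continuous_map X X (\<pi> t)"
  using flow_homeomorphic by (rule homeomorphic_imp_continuous_map)

lemma flow_mem: "x \<in> S \<Longrightarrow> \<pi> t x \<in> S"
  using continuous_map_image_subset_topspace[OF flow_continuous] by blast

text \<open>Since \<open>0 + 0 = 0\<close>, the map \<open>\<pi> 0\<close> is idempotent on the
  space; being surjective as a homeomorphism, it is the identity there.\<close>

lemma flow_zero:
  assumes "x \<in> S"
  shows "\<pi> 0 x = x"
proof -
  have "\<pi> 0 ` S = S" using flow_homeomorphic by (rule homeomorphic_imp_surjective_map)
  then obtain y where "y \<in> S" "x = \<pi> 0 y" using assms by (metis imageE)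
  then show ?thesis using flow_add[of y 0 0] by simp
qed

lemma translation_topspace: "range g \<subseteq> topspace P"
  using flow_mem by (auto simp: PiE_iff)

lemma enveloping_set_closed: "closedin P E"
  unfolding enveloping_set_def by simp

lemma enveloping_set_subset: "E \<subseteq> S \<rightarrow>\<^sub>E S"
  using closedin_subset[OF enveloping_set_closed] by simp

lemma topspace_enveloping_semigroup: "topspace ES = E"
  using enveloping_set_subset unfolding enveloping_semigroup_def by auto

lemma translation_mem: "g t \<in> E"
  using closure_of_subset[OF translation_topspace] unfolding enveloping_set_def by blast

lemma enveloping_semigroup_compact: "compact_space ES"
proof -
  have "compact_space P" using flow_compact by (simp add: compact_space_product_topology)
  then show ?thesis
    using closedin_compact_space[OF _ enveloping_set_closed]
    unfolding enveloping_semigroup_def by (simp add: compact_space_subtopology)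
qed

lemma enveloping_semigroup_Hausdorff: "Hausdorff_space ES"
  using flow_Hausdorff unfolding enveloping_semigroup_def
  by (simp add: Hausdorff_space_subtopology Hausdorff_space_product_topology)

text \<open>Composing with \<open>\<pi> t\<close> on the left is continuous and permutes the
  translations by \<open>s \<mapsto> t + s\<close>, so it maps their closure into itself.\<close>

lemma translation_compose_mem:
  assumes "p \<in> E"
  shows "compose S (\<pi> t) p \<in> E"
proof -
  have "compose S (\<pi> t) ` range g \<subseteq> range g"
  proof clarify
    fix s
    have "compose S (\<pi> t) (g s) = g (t + s)"
      by (auto simp: compose_def flow_add restrict_def)
    then show "compose S (\<pi> t) (g s) \<in> range g" by blast
  qed
  then have "P closure_of (compose S (\<pi> t) ` range g) \<subseteq> E"
    unfolding enveloping_set_def by (rule closure_of_mono)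
  moreover have "compose S (\<pi> t) ` E \<subseteq> P closure_of (compose S (\<pi> t) ` range g)"
    unfolding enveloping_set_def
    by (rule continuous_map_image_closure_subset[OF continuous_map_compose_left[OF flow_continuous]])
  ultimately show ?thesis using assms by blast
qed

lemma enveloping_set_funcset: "p \<in> E \<Longrightarrow> p \<in> S \<rightarrow> S"
  using enveloping_set_subset by auto

lemma translation_compose_eq:
  assumes "p \<in> S \<rightarrow> S"
  shows "compose S (g t) p = compose S (\<pi> t) p"
  using assms by (auto simp: compose_def restrict_def fun_eq_iff)

text \<open>Second half of the usual two-stage closure argument: for fixed \<open>p\<close>, the
  continuous map \<open>q \<mapsto> q p\<close> sends the translations into the closed set
  \<open>E\<close> by the first stage, hence their closure too.\<close>

lemma enveloping_set_compose:
  assumes "p \<in> E" "q \<in> E"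
  shows "compose S q p \<in> E"
proof -
  note p = enveloping_set_funcset[OF assms(1)]
  have "(\<lambda>q. compose S q p) ` range g \<subseteq> E"
    using translation_compose_mem[OF assms(1)] translation_compose_eq[OF p] by auto
  then have "P closure_of ((\<lambda>q. compose S q p) ` range g) \<subseteq> E"
    using enveloping_set_closed by (rule closure_of_minimal)
  moreover have "(\<lambda>q. compose S q p) ` E \<subseteq> P closure_of ((\<lambda>q. compose S q p) ` range g)"
    unfolding enveloping_set_def
    by (rule continuous_map_image_closure_subset[OF continuous_map_compose_right[OF p]])
  ultimately show ?thesis using assms by blast
qed

lemma continuous_map_enveloping_compose:
  assumes "p \<in> E"
  shows "continuous_map ES ES (\<lambda>q. compose S q p)"
  unfolding enveloping_semigroup_def
  using continuous_map_from_subtopology[OF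
      continuous_map_compose_right[OF enveloping_set_funcset[OF assms]]]
    enveloping_set_compose[OF assms]
  by (auto simp: continuous_map_in_subtopology)

lemma continuous_map_enveloping_evaluation:
  assumes "x \<in> S"
  shows "continuous_map ES X (\<lambda>p. p x)"
  unfolding enveloping_semigroup_def
  using assms by (intro continuous_map_from_subtopology continuous_map_product_projection)

section \<open>Proximality and the enveloping semigroup\<close>

text \<open>The set \<open>K\<close> of all pairs \<open>(p x, p y)\<close> is compact and contains
  the orbit of \<open>(x, y)\<close>. If it missed the diagonal, its complement would be an open
  neighbourhood of the diagonal that the orbit never enters.\<close>

lemma proximal_imp_identified:
  assumes xy: "x \<in> S" "y \<in> S" and prox: "proximal X \<pi> x y"
  obtains p where "p \<in> E" "p x = p y"
proof (rule ccontr)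
  assume "\<not> thesis"
  then have no: "\<And>p. p \<in> E \<Longrightarrow> p x \<noteq> p y" using that by blast
  let ?P2 = "prod_topology X X"
  define K where "K = (\<lambda>p. (p x, p y)) ` E"
  have "continuous_map ES ?P2 (\<lambda>p. (p x, p y))"
    using xy by (intro continuous_map_pairedI continuous_map_enveloping_evaluation)
  moreover have "compactin ES E"
    using enveloping_semigroup_compact topspace_enveloping_semigroup
    unfolding compact_space_def by simp
  ultimately have "compactin ?P2 K" unfolding K_def by (rule image_compactin[rotated])
  moreover have "Hausdorff_space ?P2" using flow_Hausdorff by (simp add: Hausdorff_space_prod_topology)
  ultimately have "closedin ?P2 K" by (simp add: compactin_imp_closedin)
  then have "openin ?P2 (topspace ?P2 - K)" by blast
  moreover have "Id_on S \<subseteq> topspace ?P2 - K" using no unfolding K_def by auto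
  ultimately obtain t where t: "(\<pi> t x, \<pi> t y) \<in> topspace ?P2 - K"
    using prox proximal_compact_Hausdorff_iff[OF flow_compact flow_Hausdorff] by metis
  moreover have "(\<pi> t x, \<pi> t y) \<in> K"
    unfolding K_def by (rule image_eqI[OF _ translation_mem[of t]]) (use xy in auto)
  ultimately show False by blast
qed

text \<open>Evaluation at \<open>x\<close> is continuous and equivariant, so a neighbourhood of the
  diagonal of \<open>X\<close> pulls back to one of \<open>ES\<close>.\<close>

lemma enveloping_proximal_imp_proximal:
  assumes prox: "proximal ES (enveloping_action X \<pi>) p q" and x: "x \<in> S"
  shows "proximal X \<pi> (p x) (q x)"
  unfolding proximal_compact_Hausdorff_iff[OF flow_compact flow_Hausdorff]
proof (intro allI impI)
  fix W assume W: "openin (prod_topology X X) W" "Id_on S \<subseteq> W"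
  have "continuous_map (prod_topology ES ES) X ((\<lambda>f. f x) \<circ> fst)"
    "continuous_map (prod_topology ES ES) X ((\<lambda>f. f x) \<circ> snd)"
    by (rule continuous_map_compose[OF _ continuous_map_enveloping_evaluation[OF x]],
        simp add: continuous_map_fst continuous_map_snd)+
  then have cont: "continuous_map (prod_topology ES ES) (prod_topology X X) (\<lambda>h. (fst h x, snd h x))"
    by (intro continuous_map_pairedI) (simp_all add: o_def)
  let ?V = "{h \<in> topspace (prod_topology ES ES). (fst h x, snd h x) \<in> W}"
  have "openin (prod_topology ES ES) ?V"
    using cont W(1) by (rule openin_continuous_map_preimage)
  moreover have "Id_on (topspace ES) \<subseteq> ?V"
  proof
    fix h assume "h \<in> Id_on (topspace ES)"
    then obtain f where f: "h = (f, f)" "f \<in> topspace ES" by auto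
    then have "f x \<in> S"
      using enveloping_set_funcset x unfolding topspace_enveloping_semigroup by blast
    then show "h \<in> ?V" using W(2) f by auto
  qed
  ultimately obtain t where "(enveloping_action X \<pi> t p, enveloping_action X \<pi> t q) \<in> ?V"
    using proximal_compact_Hausdorff_iff[OF enveloping_semigroup_compact
        enveloping_semigroup_Hausdorff, THEN iffD1, OF prox] by meson
  then show "\<exists>t. (\<pi> t (p x), \<pi> t (q x)) \<in> W"
    using x by (auto simp: enveloping_action_def compose_def)
qed

text \<open>The map \<open>r \<mapsto> (r u, r e)\<close>, with \<open>e\<close> the identity
  \<open>g 0\<close>, is continuous and sends \<open>u\<close> to the diagonal point
  \<open>(u, u)\<close>. As \<open>u\<close> is a limit of translations, some \<open>g t\<close> is
  sent close to the diagonal as well, and its image is the translate by \<open>t\<close> of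
  \<open>(u, e)\<close>.\<close>

lemma idempotent_proximal_identity:
  assumes u: "u \<in> E" "compose S u u = u"
  shows "proximal ES (enveloping_action X \<pi>) u (g 0)"
  unfolding proximal_compact_Hausdorff_iff[OF enveloping_semigroup_compact
      enveloping_semigroup_Hausdorff] topspace_enveloping_semigroup
proof (intro allI impI)
  fix W assume W: "openin (prod_topology ES ES) W" "Id_on E \<subseteq> W"
  let ?f = "\<lambda>r. (compose S r u, compose S r (g 0))"
  have "continuous_map ES (prod_topology ES ES) ?f"
    using u translation_mem by (intro continuous_map_pairedI continuous_map_enveloping_compose)
  then have "openin ES {r \<in> topspace ES. ?f r \<in> W}"
    using W(1) by (rule openin_continuous_map_preimage)
  then have "openin ES {r \<in> E. ?f r \<in> W}" by (simp add: topspace_enveloping_semigroup)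
  \<comment> \<open>The closure defining \<open>E\<close> is taken in \<open>P\<close>, so an open
    set of \<open>P\<close> is needed to find a translation near \<open>u\<close>.\<close>
  then obtain G where G: "openin P G" "{r \<in> E. ?f r \<in> W} = G \<inter> E"
    unfolding enveloping_semigroup_def openin_subtopology by blast
  have "compose S u (g 0) = u"
    using enveloping_set_subset u(1)
    by (auto simp: compose_def fun_eq_iff flow_zero PiE_iff extensional_def)
  then have "?f u \<in> W" using W(2) u by auto
  then have "u \<in> G" using G(2) u by blast
  then obtain t where "g t \<in> G"
    using u(1) G(1) unfolding enveloping_set_def in_closure_of by blast
  then have "?f (g t) \<in> W" using G(2) translation_mem by blast
  moreover have "?f (g t) = (enveloping_action X \<pi> t u, enveloping_action X \<pi> t (g 0))"
    unfolding enveloping_action_def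
    using u(1) translation_mem by (simp add: translation_compose_eq enveloping_set_funcset)
  ultimately show "\<exists>t. (enveloping_action X \<pi> t u, enveloping_action X \<pi> t (g 0)) \<in> W" by auto
qed

text \<open>The left ideal \<open>I = E p\<close> is compact as the image of \<open>E\<close> under
  right translation and closed under composition because \<open>a (c p) = (a c) p\<close>. The
  Ellis-Numakura theorem applies to it as a subspace.\<close>

lemma left_ideal_idempotent:
  assumes p: "p \<in> E"
  obtains q where "q \<in> E" "compose S (compose S q p) (compose S q p) = compose S q p"
proof -
  define I where "I = (\<lambda>q. compose S q p) ` E"
  have IE: "I \<subseteq> E" using enveloping_set_compose[OF p] unfolding I_def by blast
  have "compactin ES E"
    using enveloping_semigroup_compact topspace_enveloping_semigroup
    unfolding compact_space_def by simp
  then have I: "compactin ES I"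
    unfolding I_def using continuous_map_enveloping_compose[OF p] by (rule image_compactin)
  have top: "topspace (subtopology ES I) = I"
    using IE topspace_enveloping_semigroup by auto
  have assoc: "compose S (compose S a b) c = compose S a (compose S b c)" if "c \<in> E" for a b c
    using enveloping_set_funcset[OF that] by (auto simp: compose_def fun_eq_iff)
  have ne: "I \<noteq> {}" unfolding I_def using p by blast
  have Im: "compose S a b \<in> I" if "a \<in> I" "b \<in> I" for a b
  proof -
    obtain c where "c \<in> E" "b = compose S c p" using \<open>b \<in> I\<close> unfolding I_def by blast
    then have "compose S a b = compose S (compose S a c) p" "compose S a c \<in> E"
      using assoc[OF p, of a c] enveloping_set_compose[of c a] IE \<open>a \<in> I\<close> by auto
    then show ?thesis unfolding I_def by blast
  qed
  obtain u where "u \<in> topspace (subtopology ES I)" "compose S u u = u"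
  proof (rule Ellis_Numakura[of "subtopology ES I" "compose S"])
    show "compact_space (subtopology ES I)" using I by (simp add: compact_space_subtopology)
    show "Hausdorff_space (subtopology ES I)"
      using enveloping_semigroup_Hausdorff by (simp add: Hausdorff_space_subtopology)
    show "topspace (subtopology ES I) \<noteq> {}" unfolding top by (rule ne)
    show "compose S a b \<in> topspace (subtopology ES I)"
      if "a \<in> topspace (subtopology ES I)" "b \<in> topspace (subtopology ES I)" for a b
      using Im that unfolding top by blast
    show "compose S (compose S a b) c = compose S a (compose S b c)"
      if "c \<in> topspace (subtopology ES I)" for a b c
      using assoc that IE unfolding top by blast
    show "continuous_map (subtopology ES I) (subtopology ES I) (\<lambda>q. compose S q r)"
      if "r \<in> topspace (subtopology ES I)" for r
    proof -
      have r: "r \<in> I" "r \<in> E" using that IE unfolding top by auto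
      show ?thesis
        using continuous_map_from_subtopology[OF continuous_map_enveloping_compose[OF r(2)]] Im r
        by (auto simp: continuous_map_in_subtopology)
    qed
  qed
  then have "u \<in> I" "compose S u u = u" unfolding top by auto
  then show thesis using that unfolding I_def by blast
qed

section \<open>The two implications\<close>

lemma distal_enveloping_semigroup:
  assumes "distal_flow X \<pi>"
  shows "distal_flow ES (enveloping_action X \<pi>)"
  unfolding distal_flow_def distal_pair_def topspace_enveloping_semigroup
proof (intro ballI impI notI)
  fix p q assume pq: "p \<in> E" "q \<in> E" "p \<noteq> q" "proximal ES (enveloping_action X \<pi>) p q"
  \<comment> \<open>Points of \<open>E\<close> are extensional, so distinct ones already differ at a
    point of \<open>S\<close>.\<close>
  then obtain x where x: "x \<in> S" "p x \<noteq> q x"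
    using enveloping_set_subset by (meson PiE_ext subsetD)
  have "proximal X \<pi> (p x) (q x)" using pq(4) x(1) by (rule enveloping_proximal_imp_proximal)
  moreover have "p x \<in> S" "q x \<in> S" using pq x enveloping_set_funcset by blast+
  ultimately show False using assms x unfolding distal_flow_def distal_pair_def by blast
qed

lemma distal_of_distal_enveloping_semigroup:
  assumes dist: "distal_flow ES (enveloping_action X \<pi>)"
  shows "distal_flow X \<pi>"
  unfolding distal_flow_def distal_pair_def
proof (intro ballI impI notI)
  fix x y assume xy: "x \<in> S" "y \<in> S" "x \<noteq> y" "proximal X \<pi> x y"
  then obtain p where p: "p \<in> E" "p x = p y" using proximal_imp_identified by metis
  obtain q where q: "q \<in> E" "compose S (compose S q p) (compose S q p) = compose S q p"
    using left_ideal_idempotent[OF p(1)] by metis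
  have u: "compose S q p \<in> E" using enveloping_set_compose[OF p(1) q(1)] .
  have "proximal ES (enveloping_action X \<pi>) (compose S q p) (g 0)"
    using u q(2) by (rule idempotent_proximal_identity)
  \<comment> \<open>The idempotent and the identity are proximal points of a distal flow, so they
    coincide and \<open>q\<close> is a left inverse of \<open>p\<close>.\<close>
  then have e: "compose S q p = g 0"
    using dist u translation_mem[of 0]
    unfolding distal_flow_def distal_pair_def topspace_enveloping_semigroup by blast
  have "q (p x) = x" "q (p y) = y"
    using fun_cong[OF e, of x] fun_cong[OF e, of y] xy by (auto simp: compose_def flow_zero)
  then show False using p xy by simp
qed

end

theorem theorem1:
  fixes X :: "'a topology"
    and \<pi> :: "'t::topological_group_add \<Rightarrow> 'a \<Rightarrow> 'a"
  assumes flow: "flow X \<pi>"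
    and no_isolated_points: "\<forall>x\<in>topspace X. \<not> openin X {x}"
  shows "distal_flow X \<pi> \<longleftrightarrow>
    distal_flow (enveloping_semigroup X \<pi>) (enveloping_action X \<pi>)"
  by (rule iffI[OF distal_enveloping_semigroup[OF flow] distal_of_distal_enveloping_semigroup[OF flow]])

end
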